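(* Let $(G,C,\partial)$ and $(G',C',\partial')$ be crossed modules of commutative $k$-algebras, let $f=(f_1,f_0)$ and $g=(g_1,g_0)$ be crossed module morphisms $(G,C,\partial)\to(G',C',\partial')$, and let $h:C\to G'$ be such that $(f_0,h)$ is a homotopy connecting $f$ to $g$. Then the map $$\delta:C\longrightarrow G'\rtimes C',\qquad \delta(x)=(h(x),f_0(x)),$$ is a homotopy of the corresponding $2$-algebra morphisms; that is, $\delta$ is a homotopy connecting $\Psi(f)$ to $\Psi(g)$.
   Context: Let $k$ be a commutative ring with identity. "Module" means $k$-module; "algebra" means commutative associative $k$-algebra, not necessarily with identity unless stated. Morphisms between algebras assumed to have an identity preserve the identity. **2-modules.** A $2$-module is an internal category in the category of $k$-modules: modules $M_0$ (objects) and $M_1$ (morphisms), and $k$-linear maps $s,t:M_1\to M_0$, $e:M_0\to M_1$ and $\circ: M_1\times_{M_0}M_1=\{(a,b): t(a)=s(b)\}\to M_1$, $(a,b)\mapsto a\circ b$, such that $se=te=\mathrm{id}_{M_0}$, $s(a\circ b)=s(a)$, $t(a\circ b)=t(b)$, $\circ$ is associative, and $e(s(a))\circ a=a=a\circ e(t(a))$ for all $a\in M_1$. **2-algebras.** A $2$-algebra (commutative strict $2$-algebra) $A=(A_0,A_1,s,t,e,\circ,\bullet)$ is a $2$-module $(A_0,A_1,s,t,e,\circ)$ with a functor $\bullet:A\times A\to A$, $k$-bilinear on objects and on morphisms, which is strictly associative, commutative and unital with an identity object $1\in A_0$ (identity on morphisms $e(1)$). Functoriality means that $s,t,e$ are compatible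 with $\bullet$ and $(f_1\bullet g_1)\circ(f_2\bullet g_2)=(f_1\circ f_2)\bullet(g_1\circ g_2)$ whenever $f_1\circ f_2$ and $g_1\circ g_2$ are defined. Thus $A_0,A_1$ are commutative algebras with identity under $\bullet$ and $s,t,e$ are algebra morphisms. A morphism of $2$-algebras $F=(F_1,F_0):A\to A'$ is a pair of identity-preserving $k$-algebra morphisms $F_1:A_1\to A_1'$, $F_0:A_0\to A_0'$ with $s'F_1=F_0s$, $t'F_1=F_0t$, $e'F_0=F_1e$ and $F_1(a\circ b)=F_1(a)\circ'F_1(b)$ whenever $a\circ b$ is defined. **Homotopy of 2-algebra morphisms.** For $2$-algebra morphisms $F=(F_1,F_0)$, $H=(H_1,H_0)$ from $A$ to $A'$, a homotopy connecting $F$ to $H$ is a $k$-algebra morphism $\delta:A_0\to A_1'$ with $s'\delta=F_0$, $t'\delta=H_0$, and $F_1(a)\circ'\delta(t(a))=\delta(s(a))\circ'H_1(a)$ for all $a\in A_1$. **Crossed modules.** A crossed module of commutative $k$-algebras $(G,C,\partial)$ consists of a commutative $k$-algebra $C$ with identity, a commutative $C$-algebra $G$ (not necessarily with identity), with action written $c\blacktriangleright u$ ($c\in C$, $u\in G$), and a $k$-algebra morphism $\partial:G\to C$ such that $\partial(c\blacktriangleright u)=c\,\partial(u)$ and $\partial(u)\blacktriangleright u'=uu'$ for all $c\in C$, $u,u'\in G$. A morphism $(f_1,f_0):(G,C,\partial)\to(G',C',\partial')$ is a pair of $k$-algebra morphisms $f_1:G\to G'$, $f_0:C\to C'$ with $\partial'f_1=f_0\partial$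 and $f_1(c\blacktriangleright u)=f_0(c)\blacktriangleright f_1(u)$. **Homotopy of crossed module morphisms.** Given an algebra morphism $f_0:C\to C'$, an $f_0$-derivation is a $k$-linear map $h:C\to G'$ with $h(xx')=f_0(x)\blacktriangleright h(x')+f_0(x')\blacktriangleright h(x)+h(x)h(x')$ for all $x,x'\in C$. For crossed module morphisms $f=(f_1,f_0)$ and $g=(g_1,g_0)$ from $(G,C,\partial)$ to $(G',C',\partial')$, $(f_0,h)$ is a homotopy connecting $f$ to $g$ if $h$ is an $f_0$-derivation, $g_0(x)=f_0(x)+\partial'(h(x))$ for all $x\in C$, and $g_1(u)=f_1(u)+h(\partial(u))$ for all $u\in G$. **The functor $\Psi$ from crossed modules to 2-algebras.** For a crossed module $(G,C,\partial)$, the semidirect product $G\rtimes C$ is the $k$-module $G\times C$ with multiplication $(u,c)(u',c')=(c\blacktriangleright u'+c'\blacktriangleright u+uu',\,cc')$. $\Psi(G,C,\partial)=(C,\,G\rtimes C,\,s,t,e,\circ,\bullet)$, where $s(u,c)=c$, $t(u,c)=\partial(u)+c$, $e(c)=(0,c)$, $(u,c)\circ(u',\partial(u)+c)=(u+u',c)$, and $\bullet$ is the multiplication of $C$ on objects and of $G\rtimes C$ on morphisms. For a crossed module morphism $f=(f_1,f_0)$, $\Psi(f)=(F_1,F_0)$ with $F_1(u,c)=(f_1(u),f_0(c))$ and $F_0=f_0$. *)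

theory Defs
  imports "HOL-Algebra.Module"
begin

section \<open>Algebras and their morphisms\<close>

text \<open>Commutative associative algebras over a commutative ring, not necessarily with identity:
  the field \<open>one\<close> of the underlying record carries no meaning here. Commutative algebras
  with identity are the library locale \<^locale>\<open>algebra\<close>.\<close>

locale nonunital_algebra = module +
  assumes mult_closed:
      "\<lbrakk>x \<in> carrier M; y \<in> carrier M\<rbrakk> \<Longrightarrow> x \<otimes>\<^bsub>M\<^esub> y \<in> carrier M"
    and mult_assoc:
      "\<lbrakk>x \<in> carrier M; y \<in> carrier M; z \<in> carrier M\<rbrakk> \<Longrightarrow>
        (x \<otimes>\<^bsub>M\<^esub> y) \<otimes>\<^bsub>M\<^esub> z = x \<otimes>\<^bsub>M\<^esub> (y \<otimes>\<^bsub>M\<^esub> z)"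
    and mult_comm:
      "\<lbrakk>x \<in> carrier M; y \<in> carrier M\<rbrakk> \<Longrightarrow> x \<otimes>\<^bsub>M\<^esub> y = y \<otimes>\<^bsub>M\<^esub> x"
    and mult_distr:
      "\<lbrakk>x \<in> carrier M; y \<in> carrier M; z \<in> carrier M\<rbrakk> \<Longrightarrow>
        (x \<oplus>\<^bsub>M\<^esub> y) \<otimes>\<^bsub>M\<^esub> z = x \<otimes>\<^bsub>M\<^esub> z \<oplus>\<^bsub>M\<^esub> y \<otimes>\<^bsub>M\<^esub> z"
    and smult_mult:
      "\<lbrakk>a \<in> carrier R; x \<in> carrier M; y \<in> carrier M\<rbrakk> \<Longrightarrow>
        (a \<odot>\<^bsub>M\<^esub> x) \<otimes>\<^bsub>M\<^esub> y = a \<odot>\<^bsub>M\<^esub> (x \<otimes>\<^bsub>M\<^esub> y)"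

definition linear_maps ::
  "('k, 'm) ring_scheme \<Rightarrow> ('k, 'a) module \<Rightarrow> ('k, 'b) module \<Rightarrow> ('a \<Rightarrow> 'b) set" where
  "linear_maps k M N = {h. h \<in> carrier M \<rightarrow> carrier N \<and>
     (\<forall>x\<in>carrier M. \<forall>y\<in>carrier M. h (x \<oplus>\<^bsub>M\<^esub> y) = h x \<oplus>\<^bsub>N\<^esub> h y) \<and>
     (\<forall>r\<in>carrier k. \<forall>x\<in>carrier M. h (r \<odot>\<^bsub>M\<^esub> x) = r \<odot>\<^bsub>N\<^esub> h x)}"

definition nonunital_alg_hom ::
  "('k, 'm) ring_scheme \<Rightarrow> ('k, 'a) module \<Rightarrow> ('k, 'b) module \<Rightarrow> ('a \<Rightarrow> 'b) set" where
  "nonunital_alg_hom k M N = {h \<in> linear_maps k M N.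
     \<forall>x\<in>carrier M. \<forall>y\<in>carrier M. h (x \<otimes>\<^bsub>M\<^esub> y) = h x \<otimes>\<^bsub>N\<^esub> h y}"

definition unital_alg_hom ::
  "('k, 'm) ring_scheme \<Rightarrow> ('k, 'a) module \<Rightarrow> ('k, 'b) module \<Rightarrow> ('a \<Rightarrow> 'b) set" where
  "unital_alg_hom k M N = {h \<in> nonunital_alg_hom k M N. h \<one>\<^bsub>M\<^esub> = \<one>\<^bsub>N\<^esub>}"


section \<open>2-modules and 2-algebras\<close>

text \<open>The composite \<open>a \<circ> b\<close> (first \<open>a\<close>, then \<open>b\<close>) is \<open>vcomp A a b\<close>; its value is meaningful
  only when \<open>tgt A a = src A b\<close>. The functor \<open>\<bullet>\<close> is the ring multiplication of the records
  \<open>ob A\<close> and \<open>mor A\<close>.\<close>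

record ('k, 'a, 'b) two_struct =
  ob :: "('k, 'a) module"
  mor :: "('k, 'b) module"
  src :: "'b \<Rightarrow> 'a"
  tgt :: "'b \<Rightarrow> 'a"
  idm :: "'a \<Rightarrow> 'b"
  vcomp :: "'b \<Rightarrow> 'b \<Rightarrow> 'b"

locale two_module =
  fixes k :: "('k, 'm) ring_scheme" and A :: "('k, 'a, 'b) two_struct"
  assumes ob_module: "module k (ob A)"
    and mor_module: "module k (mor A)"
    and src_linear: "src A \<in> linear_maps k (mor A) (ob A)"
    and tgt_linear: "tgt A \<in> linear_maps k (mor A) (ob A)"
    and idm_linear: "idm A \<in> linear_maps k (ob A) (mor A)"
    and comp_closed:
      "\<lbrakk>a \<in> carrier (mor A); b \<in> carrier (mor A); tgt A a = src A b\<rbrakk> \<Longrightarrow>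
        vcomp A a b \<in> carrier (mor A)"
    and comp_add:
      "\<lbrakk>a \<in> carrier (mor A); b \<in> carrier (mor A); tgt A a = src A b;
        a' \<in> carrier (mor A); b' \<in> carrier (mor A); tgt A a' = src A b'\<rbrakk> \<Longrightarrow>
        vcomp A (a \<oplus>\<^bsub>mor A\<^esub> a') (b \<oplus>\<^bsub>mor A\<^esub> b') = vcomp A a b \<oplus>\<^bsub>mor A\<^esub> vcomp A a' b'"
    and comp_smult:
      "\<lbrakk>r \<in> carrier k; a \<in> carrier (mor A); b \<in> carrier (mor A); tgt A a = src A b\<rbrakk> \<Longrightarrow>
        vcomp A (r \<odot>\<^bsub>mor A\<^esub> a) (r \<odot>\<^bsub>mor A\<^esub> b) = r \<odot>\<^bsub>mor A\<^esub> vcomp A a b"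
    and src_idm: "x \<in> carrier (ob A) \<Longrightarrow> src A (idm A x) = x"
    and tgt_idm: "x \<in> carrier (ob A) \<Longrightarrow> tgt A (idm A x) = x"
    and src_comp:
      "\<lbrakk>a \<in> carrier (mor A); b \<in> carrier (mor A); tgt A a = src A b\<rbrakk> \<Longrightarrow>
        src A (vcomp A a b) = src A a"
    and tgt_comp:
      "\<lbrakk>a \<in> carrier (mor A); b \<in> carrier (mor A); tgt A a = src A b\<rbrakk> \<Longrightarrow>
        tgt A (vcomp A a b) = tgt A b"
    and comp_assoc:
      "\<lbrakk>a \<in> carrier (mor A); b \<in> carrier (mor A); c \<in> carrier (mor A);
        tgt A a = src A b; tgt A b = src A c\<rbrakk> \<Longrightarrow>
        vcomp A (vcomp A a b) c = vcomp A a (vcomp A b c)"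
    and idm_comp: "a \<in> carrier (mor A) \<Longrightarrow> vcomp A (idm A (src A a)) a = a"
    and comp_idm: "a \<in> carrier (mor A) \<Longrightarrow> vcomp A a (idm A (tgt A a)) = a"

text \<open>That \<open>e(1)\<close> is the identity of the algebra of morphisms is contained in
  \<open>idm_alg_hom\<close>.\<close>

locale two_algebra = two_module +
  assumes ob_algebra: "algebra k (ob A)"
    and mor_algebra: "algebra k (mor A)"
    and src_alg_hom: "src A \<in> unital_alg_hom k (mor A) (ob A)"
    and tgt_alg_hom: "tgt A \<in> unital_alg_hom k (mor A) (ob A)"
    and idm_alg_hom: "idm A \<in> unital_alg_hom k (ob A) (mor A)"
    and interchange:
      "\<lbrakk>f\<^sub>1 \<in> carrier (mor A); f\<^sub>2 \<in> carrier (mor A); tgt A f\<^sub>1 = src A f\<^sub>2;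
        g\<^sub>1 \<in> carrier (mor A); g\<^sub>2 \<in> carrier (mor A); tgt A g\<^sub>1 = src A g\<^sub>2\<rbrakk> \<Longrightarrow>
        vcomp A (f\<^sub>1 \<otimes>\<^bsub>mor A\<^esub> g\<^sub>1) (f\<^sub>2 \<otimes>\<^bsub>mor A\<^esub> g\<^sub>2) =
        vcomp A f\<^sub>1 f\<^sub>2 \<otimes>\<^bsub>mor A\<^esub> vcomp A g\<^sub>1 g\<^sub>2"

text \<open>Morphisms are pairs \<open>(F\<^sub>1, F\<^sub>0)\<close>, the component on morphisms coming first.\<close>

definition two_alg_hom ::
  "('k, 'm) ring_scheme \<Rightarrow> ('k, 'a, 'b) two_struct \<Rightarrow> ('k, 'c, 'd) two_struct
    \<Rightarrow> (('b \<Rightarrow> 'd) \<times> ('a \<Rightarrow> 'c)) set" where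
  "two_alg_hom k A A' = {(F\<^sub>1, F\<^sub>0).
     F\<^sub>1 \<in> unital_alg_hom k (mor A) (mor A') \<and>
     F\<^sub>0 \<in> unital_alg_hom k (ob A) (ob A') \<and>
     (\<forall>a\<in>carrier (mor A). src A' (F\<^sub>1 a) = F\<^sub>0 (src A a)) \<and>
     (\<forall>a\<in>carrier (mor A). tgt A' (F\<^sub>1 a) = F\<^sub>0 (tgt A a)) \<and>
     (\<forall>x\<in>carrier (ob A). idm A' (F\<^sub>0 x) = F\<^sub>1 (idm A x)) \<and>
     (\<forall>a\<in>carrier (mor A). \<forall>b\<in>carrier (mor A). tgt A a = src A b \<longrightarrow>
        F\<^sub>1 (vcomp A a b) = vcomp A' (F\<^sub>1 a) (F\<^sub>1 b))}"

text \<open>Being a homotopy includes that its ends are morphisms of 2-algebras.\<close>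

definition two_alg_homotopy ::
  "('k, 'm) ring_scheme \<Rightarrow> ('k, 'a, 'b) two_struct \<Rightarrow> ('k, 'c, 'd) two_struct
    \<Rightarrow> ('b \<Rightarrow> 'd) \<times> ('a \<Rightarrow> 'c) \<Rightarrow> ('b \<Rightarrow> 'd) \<times> ('a \<Rightarrow> 'c) \<Rightarrow> ('a \<Rightarrow> 'd) \<Rightarrow> bool" where
  "two_alg_homotopy k A A' = (\<lambda>(F\<^sub>1, F\<^sub>0) (H\<^sub>1, H\<^sub>0) \<delta>.
     two_algebra k A \<and> two_algebra k A' \<and>
     (F\<^sub>1, F\<^sub>0) \<in> two_alg_hom k A A' \<and> (H\<^sub>1, H\<^sub>0) \<in> two_alg_hom k A A' \<and>
     \<delta> \<in> unital_alg_hom k (ob A) (mor A') \<and>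
     (\<forall>x\<in>carrier (ob A). src A' (\<delta> x) = F\<^sub>0 x) \<and>
     (\<forall>x\<in>carrier (ob A). tgt A' (\<delta> x) = H\<^sub>0 x) \<and>
     (\<forall>a\<in>carrier (mor A).
        vcomp A' (F\<^sub>1 a) (\<delta> (tgt A a)) = vcomp A' (\<delta> (src A a)) (H\<^sub>1 a)))"


section \<open>Crossed modules\<close>

text \<open>In \<open>(G, C, \<partial>)\<close>, the algebra \<open>G\<close> is \<open>xtop\<close>, \<open>C\<close> is \<open>xbase\<close>, \<open>\<partial>\<close> is \<open>bdry\<close>, and
  \<open>act X c u\<close> is the action of \<open>c\<close> on \<open>u\<close>.\<close>

record ('k, 'g, 'c) xmod =
  xtop :: "('k, 'g) module"
  xbase :: "('k, 'c) module"
  act :: "'c \<Rightarrow> 'g \<Rightarrow> 'g"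
  bdry :: "'g \<Rightarrow> 'c"

text \<open>The ring (or algebra) \<open>G\<close> with its scalar multiplication replaced by \<open>\<rho>\<close>, which may have
  scalars of another type.\<close>

definition with_scalars :: "('k, 'g) module \<Rightarrow> ('c \<Rightarrow> 'g \<Rightarrow> 'g) \<Rightarrow> ('c, 'g) module" where
  "with_scalars G \<rho> = \<lparr>carrier = carrier G, mult = mult G, one = one G,
     zero = zero G, add = add G, smult = \<rho>\<rparr>"

text \<open>\<open>act_smult\<close> says that the \<open>k\<close>-module structure of \<open>G\<close> is the one coming from its
  \<open>C\<close>-algebra structure; together with \<open>top_C_algebra\<close> it makes the action \<open>k\<close>-bilinear.\<close>

locale crossed_module =
  fixes k :: "('k, 'm) ring_scheme" and X :: "('k, 'g, 'c) xmod"
  assumes base_algebra: "algebra k (xbase X)"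
    and top_algebra: "nonunital_algebra k (xtop X)"
    and top_C_algebra: "nonunital_algebra (xbase X) (with_scalars (xtop X) (act X))"
    and act_smult:
      "\<lbrakk>r \<in> carrier k; c \<in> carrier (xbase X); u \<in> carrier (xtop X)\<rbrakk> \<Longrightarrow>
        act X (r \<odot>\<^bsub>xbase X\<^esub> c) u = r \<odot>\<^bsub>xtop X\<^esub> act X c u"
    and bdry_hom: "bdry X \<in> nonunital_alg_hom k (xtop X) (xbase X)"
    and bdry_act:
      "\<lbrakk>c \<in> carrier (xbase X); u \<in> carrier (xtop X)\<rbrakk> \<Longrightarrow>
        bdry X (act X c u) = c \<otimes>\<^bsub>xbase X\<^esub> bdry X u"
    and peiffer:
      "\<lbrakk>u \<in> carrier (xtop X); u' \<in> carrier (xtop X)\<rbrakk> \<Longrightarrow>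
        act X (bdry X u) u' = u \<otimes>\<^bsub>xtop X\<^esub> u'"

definition xmod_hom ::
  "('k, 'm) ring_scheme \<Rightarrow> ('k, 'g, 'c) xmod \<Rightarrow> ('k, 'g2, 'c2) xmod
    \<Rightarrow> (('g \<Rightarrow> 'g2) \<times> ('c \<Rightarrow> 'c2)) set" where
  "xmod_hom k X X' = {(f\<^sub>1, f\<^sub>0).
     f\<^sub>1 \<in> nonunital_alg_hom k (xtop X) (xtop X') \<and>
     f\<^sub>0 \<in> unital_alg_hom k (xbase X) (xbase X') \<and>
     (\<forall>u\<in>carrier (xtop X). bdry X' (f\<^sub>1 u) = f\<^sub>0 (bdry X u)) \<and>
     (\<forall>c\<in>carrier (xbase X). \<forall>u\<in>carrier (xtop X). f\<^sub>1 (act X c u) = act X' (f\<^sub>0 c) (f\<^sub>1 u))}"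

definition derivations ::
  "('k, 'm) ring_scheme \<Rightarrow> ('k, 'g, 'c) xmod \<Rightarrow> ('k, 'g2, 'c2) xmod
    \<Rightarrow> ('c \<Rightarrow> 'c2) \<Rightarrow> ('c \<Rightarrow> 'g2) set" where
  "derivations k X X' f\<^sub>0 = {h \<in> linear_maps k (xbase X) (xtop X').
     \<forall>x\<in>carrier (xbase X). \<forall>x'\<in>carrier (xbase X).
       h (x \<otimes>\<^bsub>xbase X\<^esub> x') =
         act X' (f\<^sub>0 x) (h x') \<oplus>\<^bsub>xtop X'\<^esub> act X' (f\<^sub>0 x') (h x) \<oplus>\<^bsub>xtop X'\<^esub> h x \<otimes>\<^bsub>xtop X'\<^esub> h x'}"

text \<open>\<open>xmod_homotopy k X X' (f\<^sub>1, f\<^sub>0) (g\<^sub>1, g\<^sub>0) h\<close> means that the pair \<open>(f\<^sub>0, h)\<close> is a homotopy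
  connecting \<open>(f\<^sub>1, f\<^sub>0)\<close> to \<open>(g\<^sub>1, g\<^sub>0)\<close>.\<close>

definition xmod_homotopy ::
  "('k, 'm) ring_scheme \<Rightarrow> ('k, 'g, 'c) xmod \<Rightarrow> ('k, 'g2, 'c2) xmod
    \<Rightarrow> ('g \<Rightarrow> 'g2) \<times> ('c \<Rightarrow> 'c2) \<Rightarrow> ('g \<Rightarrow> 'g2) \<times> ('c \<Rightarrow> 'c2) \<Rightarrow> ('c \<Rightarrow> 'g2) \<Rightarrow> bool" where
  "xmod_homotopy k X X' = (\<lambda>(f\<^sub>1, f\<^sub>0) (g\<^sub>1, g\<^sub>0) h.
     crossed_module k X \<and> crossed_module k X' \<and>
     (f\<^sub>1, f\<^sub>0) \<in> xmod_hom k X X' \<and> (g\<^sub>1, g\<^sub>0) \<in> xmod_hom k X X' \<and>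
     h \<in> derivations k X X' f\<^sub>0 \<and>
     (\<forall>x\<in>carrier (xbase X). g\<^sub>0 x = f\<^sub>0 x \<oplus>\<^bsub>xbase X'\<^esub> bdry X' (h x)) \<and>
     (\<forall>u\<in>carrier (xtop X). g\<^sub>1 u = f\<^sub>1 u \<oplus>\<^bsub>xtop X'\<^esub> h (bdry X u)))"


section \<open>From crossed modules to 2-algebras\<close>

definition semidirect :: "('k, 'g, 'c) xmod \<Rightarrow> ('k, 'g \<times> 'c) module" where
  "semidirect X =
    \<lparr>carrier = carrier (xtop X) \<times> carrier (xbase X),
     mult = (\<lambda>(u, c) (u', c').
       (act X c u' \<oplus>\<^bsub>xtop X\<^esub> act X c' u \<oplus>\<^bsub>xtop X\<^esub> u \<otimes>\<^bsub>xtop X\<^esub> u', c \<otimes>\<^bsub>xbase X\<^esub> c')),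
     one = (\<zero>\<^bsub>xtop X\<^esub>, \<one>\<^bsub>xbase X\<^esub>),
     zero = (\<zero>\<^bsub>xtop X\<^esub>, \<zero>\<^bsub>xbase X\<^esub>),
     add = (\<lambda>(u, c) (u', c'). (u \<oplus>\<^bsub>xtop X\<^esub> u', c \<oplus>\<^bsub>xbase X\<^esub> c')),
     smult = (\<lambda>r (u, c). (r \<odot>\<^bsub>xtop X\<^esub> u, r \<odot>\<^bsub>xbase X\<^esub> c))\<rparr>"

text \<open>In \<open>vcomp\<close> the second component of the second argument is ignored: for composable
  arguments it is \<open>\<partial> u + c\<close>.\<close>

definition Psi :: "('k, 'g, 'c) xmod \<Rightarrow> ('k, 'c, 'g \<times> 'c) two_struct" where
  "Psi X =
    \<lparr>ob = xbase X,
     mor = semidirect X,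
     src = (\<lambda>(u, c). c),
     tgt = (\<lambda>(u, c). bdry X u \<oplus>\<^bsub>xbase X\<^esub> c),
     idm = (\<lambda>c. (\<zero>\<^bsub>xtop X\<^esub>, c)),
     vcomp = (\<lambda>(u, c) (u', _). (u \<oplus>\<^bsub>xtop X\<^esub> u', c))\<rparr>"

definition Psi_hom ::
  "('g \<Rightarrow> 'g2) \<times> ('c \<Rightarrow> 'c2) \<Rightarrow> ('g \<times> 'c \<Rightarrow> 'g2 \<times> 'c2) \<times> ('c \<Rightarrow> 'c2)" where
  "Psi_hom = (\<lambda>(f\<^sub>1, f\<^sub>0). (\<lambda>(u, c). (f\<^sub>1 u, f\<^sub>0 c), f\<^sub>0))"

end

theory Submission
  imports Defs
begin

section \<open>Arithmetic in a crossed module\<close>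

text \<open>Write c.u for the action and read a pair (u, c) of the semidirect product as a formal
  sum u + c. Multiplicativity of \<delta> = (h, f0) is then exactly the derivation rule of h, its
  target is g0 by the homotopy equation on C, and naturality at (u, c) becomes f1 u + h(\<partial> u
  + c) = h c + g1 u, which is additivity of h together with the homotopy equation on G. Less
  immediate is that \<delta> preserves the identity, that is h 1 = 0; this is
  \<open>xmod_homotopy_one\<close>. Since \<open>two_alg_homotopy\<close> also requires 2-algebras
  and 2-algebra morphisms at its ends, most of the work lies in \<open>two_algebra_Psi\<close>,
  where the Peiffer identity yields \<open>Psi_interchange\<close>, and in
  \<open>two_alg_hom_Psi_hom\<close>.\<close>

context crossed_module
begin

sublocale C: cring "xbase X"
  using base_algebra by (rule algebra.M_cring)

text \<open>The \<open>one\<close> field of \<open>xtop X\<close> carries no meaning, so only the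
  additive group is interpreted; the laws of the product are collected by name below.\<close>

sublocale G: abelian_group "xtop X"
  using top_algebra unfolding nonunital_algebra_def module_def by blast

lemma cring_k: "cring k"
  using base_algebra by (rule algebra.R_cring)

lemmas C_smult_closed [simp, intro] = module.smult_closed [OF algebra.module [OF base_algebra]]
lemmas C_smult_l_distr = module.smult_l_distr [OF algebra.module [OF base_algebra]]
lemmas C_smult_r_distr = module.smult_r_distr [OF algebra.module [OF base_algebra]]
lemmas C_smult_assoc1 = module.smult_assoc1 [OF algebra.module [OF base_algebra]]
lemmas C_smult_one = module.smult_one [OF algebra.module [OF base_algebra]]
lemmas C_smult_assoc2 = algebra.smult_assoc2 [OF base_algebra]

lemma top_module: "module k (xtop X)"
  using top_algebra by (rule nonunital_algebra.axioms(1))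

lemmas G_smult_closed [simp, intro] = module.smult_closed [OF top_module]
lemmas G_smult_l_distr = module.smult_l_distr [OF top_module]
lemmas G_smult_r_distr = module.smult_r_distr [OF top_module]
lemmas G_smult_assoc1 = module.smult_assoc1 [OF top_module]
lemmas G_smult_one = module.smult_one [OF top_module]
lemmas G_smult_zero [simp] = module.smult_r_null [OF top_module]

lemmas G_mult_closed [simp, intro] = nonunital_algebra.mult_closed [OF top_algebra]
lemmas G_mult_assoc = nonunital_algebra.mult_assoc [OF top_algebra]
lemmas G_mult_comm = nonunital_algebra.mult_comm [OF top_algebra]
lemmas G_distr_l = nonunital_algebra.mult_distr [OF top_algebra]
lemmas G_smult_mult = nonunital_algebra.smult_mult [OF top_algebra]

lemma G_distr_r:
  "\<lbrakk>x \<in> carrier (xtop X); y \<in> carrier (xtop X); z \<in> carrier (xtop X)\<rbrakk> \<Longrightarrow>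
    z \<otimes>\<^bsub>xtop X\<^esub> (x \<oplus>\<^bsub>xtop X\<^esub> y) = z \<otimes>\<^bsub>xtop X\<^esub> x \<oplus>\<^bsub>xtop X\<^esub> z \<otimes>\<^bsub>xtop X\<^esub> y"
  using G_distr_l [of x y z] G_mult_comm by simp

lemma action_module: "module (xbase X) (with_scalars (xtop X) (act X))"
  using top_C_algebra by (rule nonunital_algebra.axioms(1))

lemmas act_closed [simp, intro] =
  module.smult_closed [OF action_module, unfolded with_scalars_def, simplified]
lemmas act_l_distr =
  module.smult_l_distr [OF action_module, unfolded with_scalars_def, simplified]
lemmas act_r_distr =
  module.smult_r_distr [OF action_module, unfolded with_scalars_def, simplified]
lemmas act_assoc =
  module.smult_assoc1 [OF action_module, unfolded with_scalars_def, simplified]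
lemmas act_one [simp] =
  module.smult_one [OF action_module, unfolded with_scalars_def, simplified]
lemmas act_zero_left [simp] =
  module.smult_l_null [OF action_module, unfolded with_scalars_def, simplified]
lemmas act_zero_right [simp] =
  module.smult_r_null [OF action_module, unfolded with_scalars_def, simplified]
lemmas act_mult =
  nonunital_algebra.smult_mult [OF top_C_algebra, unfolded with_scalars_def, simplified]

lemma act_mult_right:
  "\<lbrakk>c \<in> carrier (xbase X); u \<in> carrier (xtop X); v \<in> carrier (xtop X)\<rbrakk> \<Longrightarrow>
    u \<otimes>\<^bsub>xtop X\<^esub> act X c v = act X c (u \<otimes>\<^bsub>xtop X\<^esub> v)"
  using act_mult [of c v u] G_mult_comm by simp

lemma act_left_commute:
  assumes "c \<in> carrier (xbase X)" "d \<in> carrier (xbase X)" "u \<in> carrier (xtop X)"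
  shows "act X c (act X d u) = act X d (act X c u)"
  using assms by (metis act_assoc C.m_comm)

text \<open>A scalar r acts on G as the element r1 of C, and elements of C act commutingly. This is
  the other half of bilinearity, next to \<open>act_smult\<close>.\<close>

lemma act_smult_right:
  assumes "r \<in> carrier k" "c \<in> carrier (xbase X)" "u \<in> carrier (xtop X)"
  shows "act X c (r \<odot>\<^bsub>xtop X\<^esub> u) = r \<odot>\<^bsub>xtop X\<^esub> act X c u"
proof -
  have "act X c (r \<odot>\<^bsub>xtop X\<^esub> u) = act X c (act X (r \<odot>\<^bsub>xbase X\<^esub> \<one>\<^bsub>xbase X\<^esub>) u)"
    using assms by (simp add: act_smult)
  also have "\<dots> = act X (r \<odot>\<^bsub>xbase X\<^esub> \<one>\<^bsub>xbase X\<^esub>) (act X c u)"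
    using assms by (intro act_left_commute) auto
  also have "\<dots> = r \<odot>\<^bsub>xtop X\<^esub> act X c u"
    using assms by (simp add: act_smult)
  finally show ?thesis .
qed

text \<open>Zero is 0.u, and the action can be pulled out of a product: (0.u)u = 0.(uu) = 0.\<close>

lemma G_mult_zero [simp]:
  assumes "u \<in> carrier (xtop X)"
  shows "\<zero>\<^bsub>xtop X\<^esub> \<otimes>\<^bsub>xtop X\<^esub> u = \<zero>\<^bsub>xtop X\<^esub>" "u \<otimes>\<^bsub>xtop X\<^esub> \<zero>\<^bsub>xtop X\<^esub> = \<zero>\<^bsub>xtop X\<^esub>"
proof -
  show "\<zero>\<^bsub>xtop X\<^esub> \<otimes>\<^bsub>xtop X\<^esub> u = \<zero>\<^bsub>xtop X\<^esub>"
    using act_mult [of "\<zero>\<^bsub>xbase X\<^esub>" u u] assms by simp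
  then show "u \<otimes>\<^bsub>xtop X\<^esub> \<zero>\<^bsub>xtop X\<^esub> = \<zero>\<^bsub>xtop X\<^esub>"
    using G_mult_comm assms by simp
qed

lemma bdry_closed [simp, intro]: "u \<in> carrier (xtop X) \<Longrightarrow> bdry X u \<in> carrier (xbase X)"
  using bdry_hom by (auto simp: nonunital_alg_hom_def linear_maps_def)

lemma bdry_add:
  "\<lbrakk>u \<in> carrier (xtop X); v \<in> carrier (xtop X)\<rbrakk> \<Longrightarrow>
    bdry X (u \<oplus>\<^bsub>xtop X\<^esub> v) = bdry X u \<oplus>\<^bsub>xbase X\<^esub> bdry X v"
  using bdry_hom by (auto simp: nonunital_alg_hom_def linear_maps_def)

lemma bdry_smult:
  "\<lbrakk>r \<in> carrier k; u \<in> carrier (xtop X)\<rbrakk> \<Longrightarrow>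
    bdry X (r \<odot>\<^bsub>xtop X\<^esub> u) = r \<odot>\<^bsub>xbase X\<^esub> bdry X u"
  using bdry_hom by (auto simp: nonunital_alg_hom_def linear_maps_def)

lemma bdry_mult:
  "\<lbrakk>u \<in> carrier (xtop X); v \<in> carrier (xtop X)\<rbrakk> \<Longrightarrow>
    bdry X (u \<otimes>\<^bsub>xtop X\<^esub> v) = bdry X u \<otimes>\<^bsub>xbase X\<^esub> bdry X v"
  using bdry_hom by (auto simp: nonunital_alg_hom_def linear_maps_def)

lemma bdry_zero [simp]: "bdry X \<zero>\<^bsub>xtop X\<^esub> = \<zero>\<^bsub>xbase X\<^esub>"
  using bdry_act [of "\<zero>\<^bsub>xbase X\<^esub>" "\<zero>\<^bsub>xtop X\<^esub>"] by simp

section \<open>The 2-algebra of a crossed module\<close>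

text \<open>Expands to sums of iterated actions on products of elements of G. The order of the
  actions and of the factors is left alone, so proofs add the instances of commutativity they
  need.\<close>

lemmas G_norm = act_l_distr act_r_distr act_assoc act_mult act_mult_right G_distr_l G_distr_r
  G_mult_assoc G.a_assoc G.a_comm G.a_lcomm

lemma semidirect_abelian_group: "abelian_group (semidirect X)"
proof (rule abelian_groupI)
  fix x assume "x \<in> carrier (semidirect X)"
  then obtain u c where x: "x = (u, c)" "u \<in> carrier (xtop X)" "c \<in> carrier (xbase X)"
    by (auto simp: semidirect_def)
  then show "\<exists>y\<in>carrier (semidirect X). y \<oplus>\<^bsub>semidirect X\<^esub> x = \<zero>\<^bsub>semidirect X\<^esub>"
    by (intro bexI [of _ "(\<ominus>\<^bsub>xtop X\<^esub> u, \<ominus>\<^bsub>xbase X\<^esub> c)"])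
       (auto simp: semidirect_def G.l_neg C.l_neg)
qed (auto simp: semidirect_def G.a_assoc G.a_comm G.a_lcomm C.a_assoc C.a_comm C.a_lcomm)

lemma semidirect_comm_monoid: "comm_monoid (semidirect X)"
proof (rule comm_monoidI)
  fix x y z
  assume "x \<in> carrier (semidirect X)" "y \<in> carrier (semidirect X)" "z \<in> carrier (semidirect X)"
  then obtain u c v d w e where
    [simp]: "x = (u, c)" "y = (v, d)" "z = (w, e)"
    and [simp]: "u \<in> carrier (xtop X)" "c \<in> carrier (xbase X)" "v \<in> carrier (xtop X)"
      "d \<in> carrier (xbase X)" "w \<in> carrier (xtop X)" "e \<in> carrier (xbase X)"
    by (auto simp: semidirect_def)
  \<comment> \<open>Both bracketings expand to the seven terms of (u + c)(v + d)(w + e) other than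
    cde; only these two come out with their actions in different orders.\<close>
  have e: "act X e (act X c v) = act X c (act X e v)" "act X e (act X d u) = act X d (act X e u)"
    by (simp_all add: act_left_commute)
  show "(x \<otimes>\<^bsub>semidirect X\<^esub> y) \<otimes>\<^bsub>semidirect X\<^esub> z = x \<otimes>\<^bsub>semidirect X\<^esub> (y \<otimes>\<^bsub>semidirect X\<^esub> z)"
    by (simp add: semidirect_def G_norm C.m_assoc e)
qed (auto simp: semidirect_def G_norm G_mult_comm C.m_comm)

lemma semidirect_algebra: "algebra k (semidirect X)"
proof (rule algebraI)
  show "cring (semidirect X)"
  proof (rule cringI [OF semidirect_abelian_group semidirect_comm_monoid])
    fix x y z
    assume "x \<in> carrier (semidirect X)" "y \<in> carrier (semidirect X)" "z \<in> carrier (semidirect X)"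
    then show "(x \<oplus>\<^bsub>semidirect X\<^esub> y) \<otimes>\<^bsub>semidirect X\<^esub> z =
        x \<otimes>\<^bsub>semidirect X\<^esub> z \<oplus>\<^bsub>semidirect X\<^esub> y \<otimes>\<^bsub>semidirect X\<^esub> z"
      by (auto simp: semidirect_def G_norm C.l_distr)
  qed
qed (auto simp: cring_k semidirect_def C_smult_l_distr C_smult_r_distr C_smult_assoc1 C_smult_one
      C_smult_assoc2 G_smult_l_distr G_smult_r_distr G_smult_assoc1 G_smult_one G_smult_mult
      act_smult act_smult_right)

lemma src_Psi_hom: "src (Psi X) \<in> unital_alg_hom k (mor (Psi X)) (ob (Psi X))"
  by (auto simp: Psi_def semidirect_def unital_alg_hom_def nonunital_alg_hom_def linear_maps_def)

lemma idm_Psi_hom: "idm (Psi X) \<in> unital_alg_hom k (ob (Psi X)) (mor (Psi X))"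
  by (auto simp: Psi_def semidirect_def unital_alg_hom_def nonunital_alg_hom_def linear_maps_def)

text \<open>Expanding (\<partial> u + c)(\<partial> v + d) gives \<partial>(c.v + d.u + uv) + cd,
  because \<partial> is multiplicative and C-linear.\<close>

lemma tgt_Psi_hom: "tgt (Psi X) \<in> unital_alg_hom k (mor (Psi X)) (ob (Psi X))"
  by (auto simp: Psi_def semidirect_def unital_alg_hom_def nonunital_alg_hom_def linear_maps_def
      bdry_add bdry_act bdry_mult bdry_smult C_smult_r_distr C.l_distr C.r_distr
      C.a_assoc C.a_comm C.a_lcomm C.m_comm)

lemma unital_alg_hom_linear: "f \<in> unital_alg_hom k M N \<Longrightarrow> f \<in> linear_maps k M N"
  by (simp add: unital_alg_hom_def nonunital_alg_hom_def)

text \<open>By the Peiffer identity, the target \<open>\<partial> u + c\<close> of \<open>(u, c)\<close> acts on \<open>G\<close> by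
  \<open>w \<mapsto> u w + c \<triangleright> w\<close>; this is what makes composition multiplicative.\<close>

lemma Psi_interchange:
  assumes "x \<in> carrier (mor (Psi X))" "x' \<in> carrier (mor (Psi X))"
    and "tgt (Psi X) x = src (Psi X) x'"
    and "y \<in> carrier (mor (Psi X))" "y' \<in> carrier (mor (Psi X))"
    and "tgt (Psi X) y = src (Psi X) y'"
  shows "vcomp (Psi X) (x \<otimes>\<^bsub>mor (Psi X)\<^esub> y) (x' \<otimes>\<^bsub>mor (Psi X)\<^esub> y') =
    vcomp (Psi X) x x' \<otimes>\<^bsub>mor (Psi X)\<^esub> vcomp (Psi X) y y'"
proof -
  from assms obtain u c u' v d v' where
    [simp]: "x = (u, c)" "x' = (u', bdry X u \<oplus>\<^bsub>xbase X\<^esub> c)"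
      "y = (v, d)" "y' = (v', bdry X v \<oplus>\<^bsub>xbase X\<^esub> d)"
    and [simp]: "u \<in> carrier (xtop X)" "c \<in> carrier (xbase X)" "u' \<in> carrier (xtop X)"
      "v \<in> carrier (xtop X)" "d \<in> carrier (xbase X)" "v' \<in> carrier (xtop X)"
    by (auto simp: Psi_def semidirect_def)
  \<comment> \<open>The target of y acting on u' contributes vu', while the product of the
    composites contains u'v.\<close>
  have "v \<otimes>\<^bsub>xtop X\<^esub> u' = u' \<otimes>\<^bsub>xtop X\<^esub> v"
    by (simp add: G_mult_comm)
  then show ?thesis
    by (simp add: Psi_def semidirect_def G_norm peiffer)
qed

lemma two_module_Psi: "two_module k (Psi X)"
proof (rule two_module.intro)
  show "module k (ob (Psi X))" "module k (mor (Psi X))"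
    by (simp_all add: Psi_def base_algebra semidirect_algebra algebra.module)
  show "src (Psi X) \<in> linear_maps k (mor (Psi X)) (ob (Psi X))"
    "tgt (Psi X) \<in> linear_maps k (mor (Psi X)) (ob (Psi X))"
    "idm (Psi X) \<in> linear_maps k (ob (Psi X)) (mor (Psi X))"
    by (simp_all add: unital_alg_hom_linear src_Psi_hom tgt_Psi_hom idm_Psi_hom)
qed (auto simp: Psi_def semidirect_def bdry_add G_smult_r_distr
       G.a_assoc G.a_comm G.a_lcomm C.a_assoc C.a_comm C.a_lcomm)

theorem two_algebra_Psi: "two_algebra k (Psi X)"
proof (intro two_algebra.intro two_module_Psi two_algebra_axioms.intro)
  show "algebra k (ob (Psi X))" "algebra k (mor (Psi X))"
    by (simp_all add: Psi_def base_algebra semidirect_algebra)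
qed (rule src_Psi_hom tgt_Psi_hom idm_Psi_hom Psi_interchange; assumption)+

end

section \<open>Morphisms and homotopies\<close>

text \<open>The conditions hold componentwise once f1 0 = 0, which is needed because identity
  morphisms have the form (0, c). It follows from additivity by cancellation.\<close>

theorem two_alg_hom_Psi_hom:
  assumes "crossed_module k X" and "crossed_module k X'" and "(f\<^sub>1, f\<^sub>0) \<in> xmod_hom k X X'"
  shows "Psi_hom (f\<^sub>1, f\<^sub>0) \<in> two_alg_hom k (Psi X) (Psi X')"
proof -
  interpret X: crossed_module k X by fact
  interpret X': crossed_module k X' by fact
  have f1: "f\<^sub>1 \<in> carrier (xtop X) \<rightarrow> carrier (xtop X')"
    and add1: "\<And>u v. \<lbrakk>u \<in> carrier (xtop X); v \<in> carrier (xtop X)\<rbrakk> \<Longrightarrow>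
      f\<^sub>1 (u \<oplus>\<^bsub>xtop X\<^esub> v) = f\<^sub>1 u \<oplus>\<^bsub>xtop X'\<^esub> f\<^sub>1 v"
    using assms(3) by (auto simp: xmod_hom_def nonunital_alg_hom_def linear_maps_def)
  have "f\<^sub>1 \<zero>\<^bsub>xtop X\<^esub> \<oplus>\<^bsub>xtop X'\<^esub> f\<^sub>1 \<zero>\<^bsub>xtop X\<^esub> = f\<^sub>1 \<zero>\<^bsub>xtop X\<^esub>"
    using add1 [of "\<zero>\<^bsub>xtop X\<^esub>" "\<zero>\<^bsub>xtop X\<^esub>"] by simp
  then have "f\<^sub>1 \<zero>\<^bsub>xtop X\<^esub> = \<zero>\<^bsub>xtop X'\<^esub>"
    using f1 X'.G.add.l_cancel_one by blast
  with assms(3) f1 show ?thesis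
    by (auto simp: Psi_hom_def two_alg_hom_def Psi_def semidirect_def xmod_hom_def
        unital_alg_hom_def nonunital_alg_hom_def linear_maps_def Pi_iff)
qed

text \<open>The derivation rule alone only gives \<open>h(1) + h(1)\<^sup>2 = 0\<close>. Since the homotopy ends at a
  unital map, \<open>\<partial>' (h 1) = 0\<close>, so \<open>h(1)\<^sup>2 = \<partial>' (h 1) \<triangleright> h 1 = 0\<close>.\<close>

lemma xmod_homotopy_one:
  assumes "xmod_homotopy k X X' (f\<^sub>1, f\<^sub>0) (g\<^sub>1, g\<^sub>0) h"
  shows "h \<one>\<^bsub>xbase X\<^esub> = \<zero>\<^bsub>xtop X'\<^esub>"
proof -
  interpret X: crossed_module k X using assms by (simp add: xmod_homotopy_def)
  interpret X': crossed_module k X' using assms by (simp add: xmod_homotopy_def)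
  let ?h = "h \<one>\<^bsub>xbase X\<^esub>"
  from assms have f: "(f\<^sub>1, f\<^sub>0) \<in> xmod_hom k X X'" and g: "(g\<^sub>1, g\<^sub>0) \<in> xmod_hom k X X'"
    and h: "h \<in> derivations k X X' f\<^sub>0"
    and g0: "\<forall>x\<in>carrier (xbase X). g\<^sub>0 x = f\<^sub>0 x \<oplus>\<^bsub>xbase X'\<^esub> bdry X' (h x)"
    unfolding xmod_homotopy_def by simp_all
  have unital: "f\<^sub>0 \<one>\<^bsub>xbase X\<^esub> = \<one>\<^bsub>xbase X'\<^esub>" "g\<^sub>0 \<one>\<^bsub>xbase X\<^esub> = \<one>\<^bsub>xbase X'\<^esub>"
    using f g by (simp_all add: xmod_hom_def unital_alg_hom_def)
  have h_one [simp]: "?h \<in> carrier (xtop X')"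
    using h by (auto simp: derivations_def linear_maps_def)
  have "\<one>\<^bsub>xbase X'\<^esub> \<oplus>\<^bsub>xbase X'\<^esub> bdry X' ?h = \<one>\<^bsub>xbase X'\<^esub>"
    using bspec [OF g0 X.C.one_closed] by (simp add: unital)
  then have "bdry X' ?h = \<zero>\<^bsub>xbase X'\<^esub>"
    using X'.C.add.l_cancel_one h_one by blast
  then have square: "?h \<otimes>\<^bsub>xtop X'\<^esub> ?h = \<zero>\<^bsub>xtop X'\<^esub>"
    using X'.peiffer [of ?h ?h] by simp
  have "h (\<one>\<^bsub>xbase X\<^esub> \<otimes>\<^bsub>xbase X\<^esub> \<one>\<^bsub>xbase X\<^esub>) = act X' (f\<^sub>0 \<one>\<^bsub>xbase X\<^esub>) ?h
      \<oplus>\<^bsub>xtop X'\<^esub> act X' (f\<^sub>0 \<one>\<^bsub>xbase X\<^esub>) ?h \<oplus>\<^bsub>xtop X'\<^esub> ?h \<otimes>\<^bsub>xtop X'\<^esub> ?h"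
    using h X.C.one_closed unfolding derivations_def by blast
  then have "?h \<oplus>\<^bsub>xtop X'\<^esub> ?h = ?h"
    by (simp add: unital square)
  then show ?thesis
    using X'.G.add.l_cancel_one h_one by blast
qed

theorem theorem3p6:
  fixes k :: "('k, 'm) ring_scheme"
    and X :: "('k, 'g, 'c) xmod" and X' :: "('k, 'g2, 'c2) xmod"
    and f\<^sub>1 g\<^sub>1 :: "'g \<Rightarrow> 'g2" and f\<^sub>0 g\<^sub>0 :: "'c \<Rightarrow> 'c2" and h :: "'c \<Rightarrow> 'g2"
  assumes "cring k"
    and "crossed_module k X" and "crossed_module k X'"
    and "(f\<^sub>1, f\<^sub>0) \<in> xmod_hom k X X'" and "(g\<^sub>1, g\<^sub>0) \<in> xmod_hom k X X'"
    and "xmod_homotopy k X X' (f\<^sub>1, f\<^sub>0) (g\<^sub>1, g\<^sub>0) h"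
  shows "two_alg_homotopy k (Psi X) (Psi X') (Psi_hom (f\<^sub>1, f\<^sub>0)) (Psi_hom (g\<^sub>1, g\<^sub>0))
           (\<lambda>x. (h x, f\<^sub>0 x))"
proof -
  interpret X: crossed_module k X by fact
  interpret X': crossed_module k X' by fact
  have f1: "\<And>u. u \<in> carrier (xtop X) \<Longrightarrow> f\<^sub>1 u \<in> carrier (xtop X')"
    and f0: "f\<^sub>0 \<in> unital_alg_hom k (xbase X) (xbase X')"
    using assms(4) by (auto simp: xmod_hom_def nonunital_alg_hom_def linear_maps_def)
  have h: "h \<in> derivations k X X' f\<^sub>0"
    and g0: "\<And>x. x \<in> carrier (xbase X) \<Longrightarrow> g\<^sub>0 x = f\<^sub>0 x \<oplus>\<^bsub>xbase X'\<^esub> bdry X' (h x)"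
    and g1: "\<And>u. u \<in> carrier (xtop X) \<Longrightarrow> g\<^sub>1 u = f\<^sub>1 u \<oplus>\<^bsub>xtop X'\<^esub> h (bdry X u)"
    using assms(6) by (auto simp: xmod_homotopy_def)
  have f0_closed: "\<And>x. x \<in> carrier (xbase X) \<Longrightarrow> f\<^sub>0 x \<in> carrier (xbase X')"
    using f0 by (auto simp: unital_alg_hom_def nonunital_alg_hom_def linear_maps_def)
  have h_closed: "\<And>x. x \<in> carrier (xbase X) \<Longrightarrow> h x \<in> carrier (xtop X')"
    and h_add: "\<And>x y. \<lbrakk>x \<in> carrier (xbase X); y \<in> carrier (xbase X)\<rbrakk> \<Longrightarrow>
      h (x \<oplus>\<^bsub>xbase X\<^esub> y) = h x \<oplus>\<^bsub>xtop X'\<^esub> h y"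
    using h by (auto simp: derivations_def linear_maps_def)
  \<comment> \<open>The G'-component of the product of (h x, f0 x) and (h y, f0 y) is the right-hand
    side of the derivation rule.\<close>
  have "(\<lambda>x. (h x, f\<^sub>0 x)) \<in> unital_alg_hom k (xbase X) (semidirect X')"
    using f0 h xmod_homotopy_one [OF assms(6)]
    by (auto simp: semidirect_def derivations_def unital_alg_hom_def nonunital_alg_hom_def
        linear_maps_def)
  moreover have "\<forall>x\<in>carrier (xbase X). bdry X' (h x) \<oplus>\<^bsub>xbase X'\<^esub> f\<^sub>0 x = g\<^sub>0 x"
    by (simp add: g0 h_closed f0_closed X'.C.a_comm)
  \<comment> \<open>Naturality at (u, c), in the first component; in the second, both composites
    have f0 c, the source of their first factor.\<close>
  moreover have "\<forall>u\<in>carrier (xtop X). \<forall>c\<in>carrier (xbase X).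
      f\<^sub>1 u \<oplus>\<^bsub>xtop X'\<^esub> h (bdry X u \<oplus>\<^bsub>xbase X\<^esub> c) = h c \<oplus>\<^bsub>xtop X'\<^esub> g\<^sub>1 u"
    by (simp add: g1 f1 h_closed h_add X'.G.a_assoc X'.G.a_comm X'.G.a_lcomm)
  ultimately show ?thesis
    using X.two_algebra_Psi X'.two_algebra_Psi
      two_alg_hom_Psi_hom [OF assms(2,3,4)] two_alg_hom_Psi_hom [OF assms(2,3,5)]
    by (auto simp: two_alg_homotopy_def Psi_hom_def Psi_def semidirect_def)
qed

end
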